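(* Let $R$, $C$, $S$ be pairwise disjoint finite sets, $V=R\cup C\cup S$, and let $W$ be a partial latin square on $(R,C,S)$. Suppose $W$ embeds in some abelian group. Let $\mathcal{A}_W$ be the abelian group generated by $V$ subject to the relations $r+c+s=0$ for all $\{r,c,s\}\in W$, let $\nu:\mathcal{A}_W\to\mathbb{Z}\oplus\mathbb{Z}$ be the homomorphism with $\nu(r)=(1,0)$ for $r\in R$, $\nu(c)=(0,1)$ for $c\in C$ and $\nu(s)=(-1,-1)$ for $s\in S$, and let $\mathcal{C}_W=\ker\nu$. Then every minimal abelian representation $A$ of $W$ is isomorphic to a quotient of $\mathcal{C}_W$.
   Context: A partial latin square on $(R,C,S)$ is a set $W$ of triples $\{r,c,s\}$ with $r\in R$, $c\in C$, $s\in S$, such that any two elements from distinct sets among $R,C,S$ lie together in at most one triple of $W$. An embedding of $W$ in an abelian group $A$ is a function $f:V\to A$ whose restrictions to each of $R$, $C$, $S$ are injective and such that $f(r)+f(c)+f(s)=0$ for all $\{r,c,s\}\in W$; $W$ embeds in $A$ if such an $f$ exists. An abelian group $A$ is a minimal abelian representation of $W$ if $W$ embeds in $A$ and, for every embedding $f$ of $W$ in $A$, the image $f(V)$ generates $A$. (The map $\nu$ is well defined since each relation $r+c+s$ maps to $0$.) *)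

theory Defs
  imports "HOL-Algebra.Algebra"
begin

definition partial_latin_square :: "'a set \<Rightarrow> 'a set \<Rightarrow> 'a set \<Rightarrow> 'a set set \<Rightarrow> bool" where
  "partial_latin_square R C S W \<longleftrightarrow>
     (\<forall>t\<in>W. \<exists>r\<in>R. \<exists>c\<in>C. \<exists>s\<in>S. t = {r, c, s}) \<and>
     (\<forall>(P, Q)\<in>{(R, C), (R, S), (C, S)}. \<forall>x\<in>P. \<forall>y\<in>Q. \<forall>t\<in>W. \<forall>t'\<in>W.
        {x, y} \<subseteq> t \<and> {x, y} \<subseteq> t' \<longrightarrow> t = t')"

text \<open>Abelian groups are written multiplicatively, as instances of \<^locale>\<open>comm_group\<close>.
  Embeddings are total functions; only their values on \<open>R \<union> C \<union> S\<close> matter.\<close>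

definition is_embedding ::
  "'a set \<Rightarrow> 'a set \<Rightarrow> 'a set \<Rightarrow> 'a set set \<Rightarrow> ('b, 'm) monoid_scheme \<Rightarrow> ('a \<Rightarrow> 'b) \<Rightarrow> bool" where
  "is_embedding R C S W A f \<longleftrightarrow>
     f \<in> R \<union> C \<union> S \<rightarrow> carrier A \<and>
     inj_on f R \<and> inj_on f C \<and> inj_on f S \<and>
     (\<forall>r\<in>R. \<forall>c\<in>C. \<forall>s\<in>S. {r, c, s} \<in> W \<longrightarrow> f r \<otimes>\<^bsub>A\<^esub> f c \<otimes>\<^bsub>A\<^esub> f s = \<one>\<^bsub>A\<^esub>)"

definition embeds_in ::
  "'a set \<Rightarrow> 'a set \<Rightarrow> 'a set \<Rightarrow> 'a set set \<Rightarrow> ('b, 'm) monoid_scheme \<Rightarrow> bool" where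
  "embeds_in R C S W A \<longleftrightarrow> (\<exists>f. is_embedding R C S W A f)"

definition minimal_abelian_representation ::
  "'a set \<Rightarrow> 'a set \<Rightarrow> 'a set \<Rightarrow> 'a set set \<Rightarrow> ('b, 'm) monoid_scheme \<Rightarrow> bool" where
  "minimal_abelian_representation R C S W A \<longleftrightarrow>
     comm_group A \<and> embeds_in R C S W A \<and>
     (\<forall>f. is_embedding R C S W A f \<longrightarrow> generate A (f ` (R \<union> C \<union> S)) = carrier A)"

definition relators :: "'a set \<Rightarrow> 'a set \<Rightarrow> 'a set \<Rightarrow> 'a set set \<Rightarrow> ('a \<Rightarrow>\<^sub>0 int) set" where
  "relators R C S W =
     {frag_of r + frag_of c + frag_of s | r c s. r \<in> R \<and> c \<in> C \<and> s \<in> S \<and> {r, c, s} \<in> W}"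

definition relator_subgroup :: "'a set \<Rightarrow> 'a set \<Rightarrow> 'a set \<Rightarrow> 'a set set \<Rightarrow> ('a \<Rightarrow>\<^sub>0 int) set" where
  "relator_subgroup R C S W = generate (free_Abelian_group (R \<union> C \<union> S)) (relators R C S W)"

text \<open>The group \<open>\<A>\<^sub>W\<close> presented by generators \<open>R \<union> C \<union> S\<close> and relations \<open>r + c + s = 0\<close>.\<close>

definition A_group :: "'a set \<Rightarrow> 'a set \<Rightarrow> 'a set \<Rightarrow> 'a set set \<Rightarrow> ('a \<Rightarrow>\<^sub>0 int) set monoid" where
  "A_group R C S W = free_Abelian_group (R \<union> C \<union> S) Mod relator_subgroup R C S W"

definition A_gen :: "'a set \<Rightarrow> 'a set \<Rightarrow> 'a set \<Rightarrow> 'a set set \<Rightarrow> 'a \<Rightarrow> ('a \<Rightarrow>\<^sub>0 int) set" where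
  "A_gen R C S W v = relator_subgroup R C S W #>\<^bsub>free_Abelian_group (R \<union> C \<union> S)\<^esub> frag_of v"

abbreviation Z_squared :: "(int \<times> int) monoid" where
  "Z_squared \<equiv> integer_group \<times>\<times> integer_group"

definition is_nu ::
  "'a set \<Rightarrow> 'a set \<Rightarrow> 'a set \<Rightarrow> 'a set set \<Rightarrow> (('a \<Rightarrow>\<^sub>0 int) set \<Rightarrow> int \<times> int) \<Rightarrow> bool" where
  "is_nu R C S W h \<longleftrightarrow>
     h \<in> hom (A_group R C S W) Z_squared \<and>
     (\<forall>r\<in>R. h (A_gen R C S W r) = (1, 0)) \<and>
     (\<forall>c\<in>C. h (A_gen R C S W c) = (0, 1)) \<and>
     (\<forall>s\<in>S. h (A_gen R C S W s) = (-1, -1))"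

text \<open>Extensionality pins down the values outside the carrier, so that the homomorphism is unique as
  a HOL function; see \<open>is_nu_nu\<close> and \<open>is_nu_unique\<close> below.\<close>

definition nu :: "'a set \<Rightarrow> 'a set \<Rightarrow> 'a set \<Rightarrow> 'a set set \<Rightarrow> ('a \<Rightarrow>\<^sub>0 int) set \<Rightarrow> int \<times> int" where
  "nu R C S W = (THE h. is_nu R C S W h \<and> h \<in> extensional (carrier (A_group R C S W)))"

definition C_group :: "'a set \<Rightarrow> 'a set \<Rightarrow> 'a set \<Rightarrow> 'a set set \<Rightarrow> ('a \<Rightarrow>\<^sub>0 int) set monoid" where
  "C_group R C S W =
     (A_group R C S W)\<lparr>carrier := kernel (A_group R C S W) Z_squared (nu R C S W)\<rparr>"

lemma hom_free_Abelian_group_eqI: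
  fixes V :: "'a set"
  assumes "group G" "g \<in> hom (free_Abelian_group V) G" "h \<in> hom (free_Abelian_group V) G"
    and eq: "\<And>v. v \<in> V \<Longrightarrow> g (frag_of v) = h (frag_of v)"
    and x: "Poly_Mapping.keys x \<subseteq> V"
  shows "g x = h x"
proof -
  interpret g: group_hom "free_Abelian_group V" G g
    using assms by (simp add: group_hom_def group_hom_axioms_def)
  interpret h: group_hom "free_Abelian_group V" G h
    using assms by (simp add: group_hom_def group_hom_axioms_def)
  show ?thesis
  proof (rule free_Abelian_group_induct[where P = "\<lambda>x. g x = h x", OF x])
    show "g 0 = h 0" using g.hom_one h.hom_one by simp
  next
    fix x y :: "'a \<Rightarrow>\<^sub>0 int"
    assume 2: "Poly_Mapping.keys x \<subseteq> V" "Poly_Mapping.keys y \<subseteq> V" "g x = h x" "g y = h y"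
    have y: "Poly_Mapping.keys (- y) \<subseteq> V" using 2 by simp
    have "f (x - y) = f x \<otimes>\<^bsub>G\<^esub> inv\<^bsub>G\<^esub> f y" if "group_hom (free_Abelian_group V) G f" for f
    proof -
      interpret f: group_hom "free_Abelian_group V" G f by fact
      show ?thesis
        using f.hom_mult[of x "- y"] f.hom_inv[of y] 2 y by simp
    qed
    then show "g (x - y) = h (x - y)"
      using g.group_hom_axioms h.group_hom_axioms 2 by metis
  qed (use eq in auto)
qed

lemma relators_subset: "relators R C S W \<subseteq> carrier (free_Abelian_group (R \<union> C \<union> S))"
proof
  fix x assume "x \<in> relators R C S W"
  then obtain r c s where *: "x = frag_of r + frag_of c + frag_of s" "r \<in> R" "c \<in> C" "s \<in> S"
    by (auto simp: relators_def)
  let ?G = "free_Abelian_group (R \<union> C \<union> S)"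
  have "frag_of r \<otimes>\<^bsub>?G\<^esub> frag_of c \<otimes>\<^bsub>?G\<^esub> frag_of s \<in> carrier ?G"
    using * by (intro monoid.m_closed group.is_monoid) (auto simp del: mult_free_Abelian_group)
  then show "x \<in> carrier ?G" using * by simp
qed

lemma relator_subgroup_normal:
  "relator_subgroup R C S W \<lhd> free_Abelian_group (R \<union> C \<union> S)"
  unfolding relator_subgroup_def
  by (intro comm_group.subgroup_imp_normal group.generate_is_subgroup abelian_free_Abelian_group
      group_free_Abelian_group relators_subset)

lemma group_Z_squared: "group Z_squared"
  by (simp add: DirProd_group)

lemma comm_group_Z_squared: "comm_group Z_squared"
  by (rule group.group_comm_groupI[OF group_Z_squared]) (auto simp: DirProd_def)

lemma is_nu_unique:
  assumes "is_nu R C S W g" "is_nu R C S W h" "P \<in> carrier (A_group R C S W)"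
  shows "g P = h P"
proof -
  let ?F = "free_Abelian_group (R \<union> C \<union> S)" and ?N = "relator_subgroup R C S W"
  have q: "(\<lambda>x. ?N #>\<^bsub>?F\<^esub> x) \<in> hom ?F (?F Mod ?N)"
    by (rule normal.r_coset_hom_Mod[OF relator_subgroup_normal])
  obtain x where x: "Poly_Mapping.keys x \<subseteq> R \<union> C \<union> S" "P = ?N #>\<^bsub>?F\<^esub> x"
    using assms(3) by (auto simp: A_group_def carrier_FactGroup)
  have hom: "f \<circ> (\<lambda>x. ?N #>\<^bsub>?F\<^esub> x) \<in> hom ?F Z_squared" if "is_nu R C S W f" for f
    using that hom_compose[OF q] by (auto simp: is_nu_def A_group_def)
  have "(g \<circ> (\<lambda>x. ?N #>\<^bsub>?F\<^esub> x)) x = (h \<circ> (\<lambda>x. ?N #>\<^bsub>?F\<^esub> x)) x"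
    by (rule hom_free_Abelian_group_eqI[OF group_Z_squared hom hom _ x(1)])
       (use assms in \<open>auto simp: is_nu_def A_gen_def\<close>)
  then show ?thesis using x by simp
qed

lemma is_nu_exists:
  assumes disj: "R \<inter> C = {}" "R \<inter> S = {}" "C \<inter> S = {}"
  shows "\<exists>h. is_nu R C S W h"
proof -
  let ?F = "free_Abelian_group (R \<union> C \<union> S)" and ?N = "relator_subgroup R C S W"
  define w :: "'a \<Rightarrow> int \<times> int"
    where "w v = (if v \<in> R then (1, 0) else if v \<in> C then (0, 1) else (-1, -1))" for v
  obtain k where k: "k \<in> hom ?F Z_squared" "\<And>v. v \<in> R \<union> C \<union> S \<Longrightarrow> k (frag_of v) = w v"
    using comm_group.free_Abelian_group_universal[OF comm_group_Z_squared, of w "R \<union> C \<union> S"]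
    by (auto simp: DirProd_def)
  interpret k: group_hom ?F Z_squared k
    using k group_Z_squared by (simp add: group_hom_def group_hom_axioms_def)
  have "relators R C S W \<subseteq> kernel ?F Z_squared k"
  proof
    fix x assume x: "x \<in> relators R C S W"
    then obtain r c s where *: "x = frag_of r + frag_of c + frag_of s" "r \<in> R" "c \<in> C" "s \<in> S"
      by (auto simp: relators_def)
    have "frag_of r + frag_of c \<in> carrier ?F"
      using k.G.m_closed[of "frag_of r" "frag_of c"] * by simp
    then have "k x = w r \<otimes>\<^bsub>Z_squared\<^esub> w c \<otimes>\<^bsub>Z_squared\<^esub> w s"
      using k.hom_mult[of "frag_of r" "frag_of c"] k.hom_mult[of "frag_of r + frag_of c" "frag_of s"]
        * k(2) by auto
    also have "\<dots> = \<one>\<^bsub>Z_squared\<^esub>"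
      using * disj by (auto simp: w_def DirProd_def)
    finally show "x \<in> kernel ?F Z_squared k"
      using subsetD[OF relators_subset x] by (simp add: kernel_def)
  qed
  then have "?N \<subseteq> kernel ?F Z_squared k"
    unfolding relator_subgroup_def
    by (rule k.G.generate_subgroup_incl[OF _ k.subgroup_kernel])
  then obtain g where g: "g \<in> hom (?F Mod ?N) Z_squared"
    "\<And>x. x \<in> carrier ?F \<Longrightarrow> g (?N #>\<^bsub>?F\<^esub> x) = k x"
    using k.FactGroup_universal_kernel[OF relator_subgroup_normal] by metis
  have "g (A_gen R C S W v) = w v" if "v \<in> R \<union> C \<union> S" for v
    using that g(2)[of "frag_of v"] k(2) by (auto simp: A_gen_def)
  then have "is_nu R C S W g"
    using g(1) disj by (auto simp: is_nu_def A_group_def w_def)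
  then show ?thesis by blast
qed

lemma A_gen_in_carrier:
  "v \<in> R \<union> C \<union> S \<Longrightarrow> A_gen R C S W v \<in> carrier (A_group R C S W)"
  by (auto simp: A_gen_def A_group_def carrier_FactGroup)

lemma is_nu_nu:
  assumes "R \<inter> C = {}" "R \<inter> S = {}" "C \<inter> S = {}"
  shows "is_nu R C S W (nu R C S W)"
proof -
  let ?A = "A_group R C S W"
  obtain h where h: "is_nu R C S W h" using is_nu_exists[OF assms] by blast
  have "group ?A"
    unfolding A_group_def by (rule normal.factorgroup_is_group[OF relator_subgroup_normal])
  then have "restrict h (carrier ?A) \<in> hom ?A Z_squared"
    using h by (auto simp: is_nu_def hom_def Pi_iff monoid.m_closed[OF group.is_monoid])
  then have *: "is_nu R C S W (restrict h (carrier ?A))"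
    using h A_gen_in_carrier[of _ R C S W] by (auto simp: is_nu_def)
  have "\<exists>!h. is_nu R C S W h \<and> h \<in> extensional (carrier ?A)"
  proof (rule ex1I[of _ "restrict h (carrier ?A)"])
    show "g = restrict h (carrier ?A)" if "is_nu R C S W g \<and> g \<in> extensional (carrier ?A)" for g
      using that is_nu_unique[OF _ *] by (intro extensionalityI[of _ "carrier ?A"]) auto
  qed (use * in auto)
  from theI'[OF this] show ?thesis unfolding nu_def by blast
qed

end

theory Submission
  imports Defs
begin

text \<open>The relations of \<open>W\<close> survive if an embedding is translated on \<open>R\<close>, \<open>C\<close> and \<open>S\<close> by three group
  elements with product \<open>\<one>\<close>, and the values at a fixed triple of \<open>W\<close> are such elements. Hence some
  embedding \<open>g\<close> sends a base point of each of \<open>R\<close>, \<open>C\<close>, \<open>S\<close> to \<open>\<one>\<close>. It extends to a homomorphism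
  \<open>\<A>\<^sub>W \<rightarrow> A\<close>, and the image of \<open>\<C>\<^sub>W\<close> contains every \<open>g x\<close>, as the image of \<open>x - x\<^sub>0 \<in> \<C>\<^sub>W\<close> for the base
  point \<open>x\<^sub>0\<close> of the same part. By minimality the restriction to \<open>\<C>\<^sub>W\<close> is onto.\<close>

lemma group_A_group: "group (A_group R C S W)"
  unfolding A_group_def by (rule normal.factorgroup_is_group[OF relator_subgroup_normal])

lemma group_hom_nu:
  assumes "R \<inter> C = {}" "R \<inter> S = {}" "C \<inter> S = {}"
  shows "group_hom (A_group R C S W) Z_squared (nu R C S W)"
  using is_nu_nu[OF assms, of W] group_A_group group_Z_squared
  by (auto simp: is_nu_def group_hom_def group_hom_axioms_def)

lemma subgroup_C_group:
  assumes "R \<inter> C = {}" "R \<inter> S = {}" "C \<inter> S = {}"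
  shows "subgroup (carrier (C_group R C S W)) (A_group R C S W)"
  using group_hom.subgroup_kernel[OF group_hom_nu[OF assms]] by (simp add: C_group_def)

lemma group_C_group:
  assumes "R \<inter> C = {}" "R \<inter> S = {}" "C \<inter> S = {}"
  shows "group (C_group R C S W)"
  using subgroup.subgroup_is_group[OF subgroup_C_group[OF assms] group_A_group]
  by (simp add: C_group_def)

text \<open>\<open>nu\<close> takes a single value on the generators of each part, so it kills their
  quotients within a part. These are the kernel elements on which the surjectivity argument
  rests.\<close>

lemma A_gen_diff_in_C_group:
  assumes disj: "R \<inter> C = {}" "R \<inter> S = {}" "C \<inter> S = {}"
    and P: "P \<in> {R, C, S}" "x \<in> P" "y \<in> P"
  shows "A_gen R C S W x \<otimes>\<^bsub>A_group R C S W\<^esub> inv\<^bsub>A_group R C S W\<^esub> A_gen R C S W y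
    \<in> carrier (C_group R C S W)"
proof -
  interpret nu: group_hom "A_group R C S W" Z_squared "nu R C S W"
    by (rule group_hom_nu[OF disj])
  have gens: "A_gen R C S W x \<in> carrier (A_group R C S W)" "A_gen R C S W y \<in> carrier (A_group R C S W)"
    using P by (auto intro!: A_gen_in_carrier)
  have eq: "nu R C S W (A_gen R C S W x) = nu R C S W (A_gen R C S W y)"
    using is_nu_nu[OF disj, of W] P by (auto simp: is_nu_def)
  have "nu R C S W (A_gen R C S W x \<otimes>\<^bsub>A_group R C S W\<^esub> inv\<^bsub>A_group R C S W\<^esub> A_gen R C S W y)
      = \<one>\<^bsub>Z_squared\<^esub>"
    using gens by (simp only: nu.hom_mult nu.hom_inv nu.G.inv_closed eq nu.H.r_inv nu.hom_closed)
  then show ?thesis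
    using gens by (simp add: C_group_def kernel_def)
qed

text \<open>The values of \<open>f\<close> extend to a homomorphism on the free abelian group. It
  kills every relator because \<open>f\<close> respects the triples of \<open>W\<close>, so it
  factors through the quotient.\<close>

lemma A_group_universal:
  assumes "comm_group A" "is_embedding R C S W A f"
  obtains h where "group_hom (A_group R C S W) A h"
    "\<And>v. v \<in> R \<union> C \<union> S \<Longrightarrow> h (A_gen R C S W v) = f v"
proof -
  let ?F = "free_Abelian_group (R \<union> C \<union> S)" and ?N = "relator_subgroup R C S W"
  interpret A: comm_group A by fact
  have f: "f ` (R \<union> C \<union> S) \<subseteq> carrier A"
    using assms(2) by (auto simp: is_embedding_def)
  obtain k where k: "k \<in> hom ?F A" "\<And>v. v \<in> R \<union> C \<union> S \<Longrightarrow> k (frag_of v) = f v"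
    using A.free_Abelian_group_universal[OF f] by blast
  interpret k: group_hom ?F A k
    using k A.is_group by (simp add: group_hom_def group_hom_axioms_def)
  have "relators R C S W \<subseteq> kernel ?F A k"
  proof
    fix x assume x: "x \<in> relators R C S W"
    then obtain r c s where *: "x = frag_of r + frag_of c + frag_of s"
      "r \<in> R" "c \<in> C" "s \<in> S" "{r, c, s} \<in> W"
      by (auto simp: relators_def)
    have "frag_of r + frag_of c \<in> carrier ?F"
      using k.G.m_closed[of "frag_of r" "frag_of c"] * by simp
    then have "k x = f r \<otimes>\<^bsub>A\<^esub> f c \<otimes>\<^bsub>A\<^esub> f s"
      using k.hom_mult[of "frag_of r" "frag_of c"] k.hom_mult[of "frag_of r + frag_of c" "frag_of s"]
        * k(2) by auto
    then show "x \<in> kernel ?F A k"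
      using * assms(2) subsetD[OF relators_subset x] by (simp add: kernel_def is_embedding_def)
  qed
  then have "?N \<subseteq> kernel ?F A k"
    unfolding relator_subgroup_def
    by (rule k.G.generate_subgroup_incl[OF _ k.subgroup_kernel])
  then obtain h where h: "h \<in> hom (?F Mod ?N) A"
    "\<And>x. x \<in> carrier ?F \<Longrightarrow> h (?N #>\<^bsub>?F\<^esub> x) = k x"
    using k.FactGroup_universal_kernel[OF relator_subgroup_normal] by metis
  show thesis
  proof
    show "group_hom (A_group R C S W) A h"
      using h(1) group_A_group A.is_group
      by (simp add: group_hom_def group_hom_axioms_def A_group_def)
    show "h (A_gen R C S W v) = f v" if "v \<in> R \<union> C \<union> S" for v
      using that h(2)[of "frag_of v"] k(2) by (auto simp: A_gen_def)
  qed
qed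

text \<open>The three translating elements, one for each part, are packed into the function
  \<open>d\<close>. Being constant on a part, \<open>d\<close> cancels there, which preserves
  injectivity; by commutativity the product over a triple splits into an \<open>f\<close>-product
  and a \<open>d\<close>-product. Premise \<open>d1\<close> speaks of triples of \<open>W\<close>
  only, so it is vacuous for empty \<open>W\<close>.\<close>

lemma is_embedding_translate:
  assumes "comm_group A" and f: "is_embedding R C S W A f"
    and d: "d \<in> R \<union> C \<union> S \<rightarrow> carrier A"
    and const: "\<And>P x y. \<lbrakk>P \<in> {R, C, S}; x \<in> P; y \<in> P\<rbrakk> \<Longrightarrow> d x = d y"
    and d1: "\<And>r c s. \<lbrakk>r \<in> R; c \<in> C; s \<in> S; {r, c, s} \<in> W\<rbrakk> \<Longrightarrow> d r \<otimes>\<^bsub>A\<^esub> d c \<otimes>\<^bsub>A\<^esub> d s = \<one>\<^bsub>A\<^esub>"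
  shows "is_embedding R C S W A (\<lambda>v. f v \<otimes>\<^bsub>A\<^esub> d v)"
proof -
  interpret A: comm_group A by fact
  have inj: "inj_on (\<lambda>v. f v \<otimes>\<^bsub>A\<^esub> d v) P" if P: "P \<in> {R, C, S}" for P
  proof (rule inj_onI)
    fix x y assume xy: "x \<in> P" "y \<in> P" "f x \<otimes>\<^bsub>A\<^esub> d x = f y \<otimes>\<^bsub>A\<^esub> d y"
    have "f x \<in> carrier A" "f y \<in> carrier A" "d y \<in> carrier A"
      using f d P xy by (auto simp: is_embedding_def)
    then have "f x = f y"
      using xy const[OF P, of x y] by simp
    then show "x = y"
      using f P xy by (auto simp: is_embedding_def dest: inj_onD)
  qed
  have "f r \<otimes>\<^bsub>A\<^esub> d r \<otimes>\<^bsub>A\<^esub> (f c \<otimes>\<^bsub>A\<^esub> d c) \<otimes>\<^bsub>A\<^esub> (f s \<otimes>\<^bsub>A\<^esub> d s) = \<one>\<^bsub>A\<^esub>"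
    if *: "r \<in> R" "c \<in> C" "s \<in> S" "{r, c, s} \<in> W" for r c s
  proof -
    have "f r \<in> carrier A" "f c \<in> carrier A" "f s \<in> carrier A"
      "d r \<in> carrier A" "d c \<in> carrier A" "d s \<in> carrier A"
      using f d * by (auto simp: is_embedding_def)
    then have "f r \<otimes>\<^bsub>A\<^esub> d r \<otimes>\<^bsub>A\<^esub> (f c \<otimes>\<^bsub>A\<^esub> d c) \<otimes>\<^bsub>A\<^esub> (f s \<otimes>\<^bsub>A\<^esub> d s)
        = (f r \<otimes>\<^bsub>A\<^esub> f c \<otimes>\<^bsub>A\<^esub> f s) \<otimes>\<^bsub>A\<^esub> (d r \<otimes>\<^bsub>A\<^esub> d c \<otimes>\<^bsub>A\<^esub> d s)"
      by (simp add: A.m_ac)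
    then show ?thesis
      using f * d1[OF *] by (simp add: is_embedding_def)
  qed
  then show ?thesis
    using f d inj by (auto simp: is_embedding_def)
qed

lemma normalized_embedding:
  assumes "comm_group A" and f: "is_embedding R C S W A f"
    and disj: "R \<inter> C = {}" "R \<inter> S = {}" "C \<inter> S = {}"
    and W: "partial_latin_square R C S W"
  obtains g where "is_embedding R C S W A g"
    "\<And>P. \<lbrakk>P \<in> {R, C, S}; P \<noteq> {}\<rbrakk> \<Longrightarrow> \<exists>x\<in>P. g x = \<one>\<^bsub>A\<^esub>"
proof -
  interpret A: comm_group A by fact
  \<comment> \<open>The base points form a triple of \<open>W\<close> if there is one. Otherwise
    there is no relation to preserve, and any point of each nonempty part will do; the implications
    allow for empty parts.\<close>
  obtain r0 c0 s0 where base: "R \<noteq> {} \<Longrightarrow> r0 \<in> R" "C \<noteq> {} \<Longrightarrow> c0 \<in> C" "S \<noteq> {} \<Longrightarrow> s0 \<in> S"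
    "W \<noteq> {} \<Longrightarrow> {r0, c0, s0} \<in> W"
  proof (cases "W = {}")
    case True
    then show thesis using that by (metis all_not_in_conv)
  next
    case False
    then obtain t where "t \<in> W" by blast
    then obtain r c s where "r \<in> R" "c \<in> C" "s \<in> S" "{r, c, s} \<in> W"
      using W by (fastforce simp: partial_latin_square_def)
    then show thesis by (rule that)
  qed
  \<comment> \<open>\<open>b\<close> sends a vertex to the base point of its part; the parts are
    disjoint, so the order of the cases does not matter.\<close>
  define b where "b v = (if v \<in> R then r0 else if v \<in> C then c0 else s0)" for v
  have b: "b x \<in> P" "b x = b y" if "P \<in> {R, C, S}" "x \<in> P" "y \<in> P" for P x y
    using that base disj by (auto simp: b_def)
  have fb: "f (b v) \<in> carrier A" if "v \<in> R \<union> C \<union> S" for v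
  proof -
    have "b v \<in> R \<union> C \<union> S"
      using that b(1)[of R v v] b(1)[of C v v] b(1)[of S v v] by blast
    then show ?thesis
      using f by (auto simp: is_embedding_def)
  qed
  define g where "g v = f v \<otimes>\<^bsub>A\<^esub> inv\<^bsub>A\<^esub> f (b v)" for v
  show thesis
  proof
    show "is_embedding R C S W A g"
      unfolding g_def
    proof (rule is_embedding_translate[OF assms(1) f])
      show "(\<lambda>v. inv\<^bsub>A\<^esub> f (b v)) \<in> R \<union> C \<union> S \<rightarrow> carrier A"
        using fb by auto
      show "inv\<^bsub>A\<^esub> f (b x) = inv\<^bsub>A\<^esub> f (b y)" if "P \<in> {R, C, S}" "x \<in> P" "y \<in> P" for P x y
        using b(2)[OF that] by simp
      show "inv\<^bsub>A\<^esub> f (b r) \<otimes>\<^bsub>A\<^esub> inv\<^bsub>A\<^esub> f (b c) \<otimes>\<^bsub>A\<^esub> inv\<^bsub>A\<^esub> f (b s) = \<one>\<^bsub>A\<^esub>"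
        if *: "r \<in> R" "c \<in> C" "s \<in> S" "{r, c, s} \<in> W" for r c s
      proof -
        have "b r = r0" "b c = c0" "b s = s0"
          using * disj by (auto simp: b_def)
        \<comment> \<open>The triple at hand shows that \<open>W\<close> is nonempty, so the base
          points form a triple of \<open>W\<close>. Inverting its relation gives the condition on
          the translating elements.\<close>
        moreover have "{r0, c0, s0} \<in> W" "r0 \<in> R" "c0 \<in> C" "s0 \<in> S"
          using * base by auto
        ultimately have "f (b r) \<otimes>\<^bsub>A\<^esub> f (b c) \<otimes>\<^bsub>A\<^esub> f (b s) = \<one>\<^bsub>A\<^esub>"
          using f by (simp add: is_embedding_def)
        then have "inv\<^bsub>A\<^esub> (f (b r) \<otimes>\<^bsub>A\<^esub> f (b c) \<otimes>\<^bsub>A\<^esub> f (b s)) = \<one>\<^bsub>A\<^esub>"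
          by simp
        then show ?thesis
          using * fb by (simp add: A.inv_mult)
      qed
    qed
    show "\<exists>x\<in>P. g x = \<one>\<^bsub>A\<^esub>" if P: "P \<in> {R, C, S}" "P \<noteq> {}" for P
    proof -
      obtain y where y: "y \<in> P" using P by blast
      \<comment> \<open>\<open>b\<close> fixes base points, so at \<open>b y\<close> the definition
        of \<open>g\<close> multiplies a value of \<open>f\<close> by its own inverse.\<close>
      have "b (b y) = b y" "b y \<in> P"
        using b[OF P(1)] y by blast+
      moreover have "f (b y) \<in> carrier A"
        using P y fb[of y] by blast
      ultimately show ?thesis
        by (intro bexI[of _ "b y"]) (simp_all add: g_def)
    qed
  qed
qed

theorem theorem4:
  fixes R C S :: "'a set" and W :: "'a set set"
    and A :: "('b, 'm) monoid_scheme" and B :: "('c, 'n) monoid_scheme"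
  assumes "finite R" "finite C" "finite S"
    and "R \<inter> C = {}" "R \<inter> S = {}" "C \<inter> S = {}"
    and "partial_latin_square R C S W"
    and "comm_group B" "embeds_in R C S W B"
    and "minimal_abelian_representation R C S W A"
  shows "\<exists>N. N \<lhd> C_group R C S W \<and> A \<cong> C_group R C S W Mod N"
proof -
  let ?V = "R \<union> C \<union> S" and ?A = "A_group R C S W" and ?C = "C_group R C S W"
  note disj = assms(4-6)
  interpret A: comm_group A
    using assms(10) by (simp add: minimal_abelian_representation_def)
  obtain f where f: "is_embedding R C S W A f"
    using assms(10) by (auto simp: minimal_abelian_representation_def embeds_in_def)
  obtain g where g: "is_embedding R C S W A g"
    "\<And>P. \<lbrakk>P \<in> {R, C, S}; P \<noteq> {}\<rbrakk> \<Longrightarrow> \<exists>x\<in>P. g x = \<one>\<^bsub>A\<^esub>"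
    using normalized_embedding[OF A.comm_group_axioms f disj assms(7)] by blast
  obtain h where h: "group_hom ?A A h" "\<And>v. v \<in> ?V \<Longrightarrow> h (A_gen R C S W v) = g v"
    using A_group_universal[OF A.comm_group_axioms g(1)] by blast
  interpret h: group_hom ?A A h by (rule h(1))
  have sub: "carrier ?C \<subseteq> carrier ?A"
    by (rule subgroup.subset[OF subgroup_C_group[OF disj]])
  have "h \<in> hom ?C A"
    using sub by (auto simp: hom_def C_group_def subset_iff)
  then interpret hC: group_hom ?C A h
    using group_C_group[OF disj] A.is_group by (simp add: group_hom_def group_hom_axioms_def)
  have "g x \<in> h ` carrier ?C" if x: "P \<in> {R, C, S}" "x \<in> P" for P x
  proof -
    obtain y where y: "y \<in> P" "g y = \<one>\<^bsub>A\<^esub>"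
      using g(2)[OF x(1)] x(2) by blast
    have xy: "x \<in> ?V" "y \<in> ?V" using x y by auto
    have gens: "A_gen R C S W x \<in> carrier ?A" "A_gen R C S W y \<in> carrier ?A"
      using xy by (auto intro!: A_gen_in_carrier)
    \<comment> \<open>The second factor vanishes because \<open>g y\<close> is the identity: this is
      what the normalization is for.\<close>
    have "h (A_gen R C S W x \<otimes>\<^bsub>?A\<^esub> inv\<^bsub>?A\<^esub> A_gen R C S W y) = g x"
      using gens xy y h.hom_closed[OF gens(1)] by (simp add: h(2))
    then show ?thesis
      using A_gen_diff_in_C_group[OF disj x y(1)] by (metis imageI)
  qed
  then have "g ` ?V \<subseteq> h ` carrier ?C" by blast
  then have "generate A (g ` ?V) \<subseteq> h ` carrier ?C"
    by (rule A.generate_subgroup_incl[OF _ hC.img_is_subgroup])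
  \<comment> \<open>Minimality speaks of every embedding, so it applies to the normalized
    \<open>g\<close> and not just to \<open>f\<close>.\<close>
  moreover have "generate A (g ` ?V) = carrier A"
    using assms(10) g(1) by (simp add: minimal_abelian_representation_def)
  ultimately have "h ` carrier ?C = carrier A"
    using hC.hom_closed by blast
  \<comment> \<open>By the first isomorphism theorem, the normal subgroup sought is the kernel of
    \<open>h\<close> restricted to \<open>?C\<close>.\<close>
  then have "?C Mod kernel ?C A h \<cong> A"
    by (rule hC.FactGroup_iso)
  then have "A \<cong> ?C Mod kernel ?C A h"
    by (rule group.iso_sym[OF normal.factorgroup_is_group[OF hC.normal_kernel]])
  then show ?thesis
    using hC.normal_kernel by blast
qed

end
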